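(* For every real $s>1$ and every integer $n\ge 1$, the following strict inequality holds: $$\frac {\Gamma (ns+1)\Gamma (2s)}{\Gamma ((n+2)s)}< \frac 1{(n+1)^s}.$$
   Context: $\Gamma$ denotes the Euler gamma function. *)

theory Defs
  imports "HOL-Analysis.Gamma_Function"
begin

end

theory Submission
  imports Defs
begin

text \<open>
  Up to the factor \<open>(n + 2) s\<close>, the left-hand side is the Beta value \<open>B (n s + 1) (2 s)\<close>, the
  integral of \<open>t^(n s) (1 - t)^(2 s - 1)\<close> over \<open>[0, 1]\<close>. At \<open>s = 1\<close> the two sides agree, since
  \<open>(n + 2) B (n + 1) 2 = 1 / (n + 1)\<close>. Moving from exponent \<open>1\<close> to \<open>s\<close> multiplies the integrand by
  \<open>(t^n (1 - t)^2)^(s - 1)\<close>, and the base of this power never exceeds \<open>1 / (3 (n + 1))\<close>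
  (\<open>power_mult_one_minus_sq_le\<close>). Hence the left-hand side is at most
  \<open>s / 3^(s - 1)\<close> times \<open>1 / (n + 1)^s\<close> (\<open>Beta_shift_le\<close>), and \<open>s = 1 + (s - 1) < exp (s - 1) \<le> 3^(s - 1)\<close>.
\<close>

text \<open>
  The exact maximum, at \<open>t = n / (n + 2)\<close>, is \<open>(n / (n + 2))^n * 4 / (n + 2)^2\<close>. By Bernoulli's
  inequality \<open>(1 + 2 / n)^n \<ge> 3\<close>, and \<open>4 (n + 1) \<le> (n + 2)^2\<close>.
\<close>

lemma power_mult_one_minus_sq_le:
  fixes t :: real
  assumes "n \<ge> 1" "0 \<le> t" "t \<le> 1"
  shows "t ^ n * (1 - t)\<^sup>2 \<le> 1 / (3 * (real n + 1))"
proof -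
  define a where "a = real n"
  have a: "a \<ge> 1" using assms by (simp add: a_def)
  \<comment> \<open>The two factors are rescaled so that both equal 1 at the maximum point; then
      \<open>x \<le> exp (x - 1)\<close> loses nothing there, and the exponents cancel.\<close>
  define u where "u = (a + 2) * t / a"
  define v where "v = (a + 2) * (1 - t) / 2"
  have uv: "0 \<le> u" "0 \<le> v" using assms a by (auto simp: u_def v_def)
  have le_exp: "x \<le> exp (x - 1)" for x :: real
    using exp_ge_add_one_self[of "x - 1"] by simp
  have "u ^ n * v\<^sup>2 \<le> exp (u - 1) ^ n * exp (v - 1) ^ 2"
    using uv le_exp by (intro mult_mono power_mono) auto
  also have "\<dots> = exp (a * (u - 1) + 2 * (v - 1))"
    by (simp add: exp_add a_def flip: exp_of_nat_mult)
  also have "a * (u - 1) + 2 * (v - 1) = 0"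
    using a by (simp add: u_def v_def field_simps)
  finally have uv1: "u ^ n * v\<^sup>2 \<le> 1" by simp
  have "3 \<le> (1 + 2 / a) ^ n"
    using Bernoulli_inequality[of "2 / a" n] a by (simp add: a_def order_trans[of "-1" 0])
  also have "1 + 2 / a = inverse (a / (a + 2))" using a by (simp add: field_simps)
  finally have bern: "(a / (a + 2)) ^ n \<le> 1 / 3"
    using a by (simp add: power_inverse field_simps)
  have "4 / (a + 2)\<^sup>2 \<le> 4 / (4 * (a + 1))"
    using a by (intro divide_left_mono) (auto simp: power2_eq_square algebra_simps add_pos_pos)
  then have sq: "4 / (a + 2)\<^sup>2 \<le> 1 / (a + 1)"
    using mult_divide_mult_cancel_left[of "4 :: real" 1 "a + 1"] by simp
  have t: "t = a / (a + 2) * u" "1 - t = 2 / (a + 2) * v"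
    using a by (auto simp: u_def v_def)
  have "t ^ n * (1 - t)\<^sup>2 = (a / (a + 2)) ^ n * (4 / (a + 2)\<^sup>2) * (u ^ n * v\<^sup>2)"
    unfolding t(2) by (subst t(1)) (simp add: power_mult_distrib power_divide)
  also have "\<dots> \<le> (1 / 3) * (1 / (a + 1)) * 1"
    using bern sq uv1 uv a by (intro mult_mono) auto
  finally show ?thesis by (simp add: a_def)
qed

text \<open>
  Adding \<open>r a\<close> and \<open>r b\<close> to the parameters multiplies the Beta integrand by
  \<open>(t^a (1 - t)^b)^r\<close>, so a uniform bound on this factor passes to the integrals.
\<close>

lemma Beta_shift_le:
  fixes p q a b c r :: real
  assumes pos: "p > 0" "q > 0" "a \<ge> 0" "b \<ge> 0" "r \<ge> 0"
    and bound: "\<And>t. 0 < t \<Longrightarrow> t < 1 \<Longrightarrow> t powr a * (1 - t) powr b \<le> c"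
  shows "Beta (p + r * a) (q + r * b) \<le> c powr r * Beta p q"
proof -
  have *: "p + r * a > 0" "q + r * b > 0"
    using pos by (auto intro: add_pos_nonneg)
  show ?thesis
  proof (rule has_integral_le[OF has_integral_Beta_real[OF *]
        has_integral_mult_right[OF has_integral_Beta_real[OF pos(1,2)]]])
    fix t :: real assume "t \<in> {0..1}"
    then consider "t = 0" | "t = 1" | "0 < t" "t < 1" by fastforce
    then show "t powr (p + r * a - 1) * (1 - t) powr (q + r * b - 1)
             \<le> c powr r * (t powr (p - 1) * (1 - t) powr (q - 1))"
    proof cases
      case 3
      have "t powr (p + r * a - 1) * (1 - t) powr (q + r * b - 1)
          = (t powr a * (1 - t) powr b) powr r * (t powr (p - 1) * (1 - t) powr (q - 1))"
        using 3 by (simp add: powr_mult powr_powr powr_add powr_diff mult_ac)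
      also have "\<dots> \<le> c powr r * (t powr (p - 1) * (1 - t) powr (q - 1))"
        using 3 pos bound[of t] by (intro mult_right_mono powr_mono2) auto
      finally show ?thesis .
    \<comment> \<open>At the endpoints both sides vanish because \<open>0 powr x = 0\<close> for every \<open>x\<close>.\<close>
    qed auto
  qed
qed

theorem theorem4p3:
  fixes s :: real and n :: nat
  assumes "s > 1" and "n \<ge> 1"
  shows "Gamma (real n * s + 1) * Gamma (2 * s) / Gamma ((real n + 2) * s)
           < 1 / (real n + 1) powr s"
proof -
  define N where "N = real n + 1"
  have N: "N > 0" by (simp add: N_def)
  have Gamma_shift: "Gamma (x + 1) = x * Gamma x" if "x > 0" for x :: real
    using that by (intro Gamma_plus1) (auto elim!: nonpos_Ints_cases)

  have G: "Gamma ((real n + 2) * s + 1) = (real n + 2) * s * Gamma ((real n + 2) * s)"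
    using assms by (intro Gamma_shift) simp
  have "Gamma ((real n + 2) * s) > 0"
    using assms by (intro Gamma_real_pos) simp
  moreover have "real n * s + 1 + 2 * s = (real n + 2) * s + 1"
    by (simp add: algebra_simps)
  moreover have "(real n + 2) * s \<noteq> 0"
    using assms by simp
  ultimately have lhs: "Gamma (real n * s + 1) * Gamma (2 * s) / Gamma ((real n + 2) * s)
      = (real n + 2) * s * Beta (real n * s + 1) (2 * s)"
    unfolding Beta_def by (simp only: G) simp

  have n2: "real n + 2 = N + 1" by (simp add: N_def)
  have "Gamma (N + 2) = (N + 1) * (N * Gamma N)"
    using N Gamma_shift[of N] Gamma_shift[of "N + 1"] by (simp add: algebra_simps)
  moreover have "Gamma N \<noteq> 0" using Gamma_real_pos[OF N] by simp
  moreover have "Gamma 2 = (1 :: real)" using Gamma_shift[of 1] by simp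
  ultimately have base: "(real n + 2) * Beta N 2 = 1 / N"
    using N unfolding Beta_def n2 by simp

  have "Beta (N + (s - 1) * real n) (2 + (s - 1) * 2) \<le> (1 / (3 * N)) powr (s - 1) * Beta N 2"
  proof (rule Beta_shift_le)
    fix t :: real assume "0 < t" "t < 1"
    then show "t powr real n * (1 - t) powr 2 \<le> 1 / (3 * N)"
      using power_mult_one_minus_sq_le[of n t] assms by (simp add: powr_realpow N_def)
  qed (use assms N in auto)
  then have "(real n + 2) * s * Beta (real n * s + 1) (2 * s)
      \<le> (real n + 2) * s * ((1 / (3 * N)) powr (s - 1) * Beta N 2)"
    using assms by (intro mult_left_mono) (simp_all add: N_def algebra_simps)
  also have "\<dots> = s * (1 / (3 * N)) powr (s - 1) * ((real n + 2) * Beta N 2)"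
    by (simp add: mult_ac)
  also have "\<dots> = s / 3 powr (s - 1) * (1 / N powr s)"
    unfolding base using N by (simp add: powr_divide powr_mult powr_diff)
  also have "\<dots> < 1 * (1 / N powr s)"
  proof (rule mult_strict_right_mono)
    have "s < exp (s - 1)"
      using assms exp_minus_greater[of "1 - s"] by simp
    also have "\<dots> = exp 1 powr (s - 1)" by (simp add: powr_def)
    also have "\<dots> \<le> 3 powr (s - 1)"
      using assms exp_le by (intro powr_mono2) auto
    finally show "s / 3 powr (s - 1) < 1" by simp
  qed (use N in simp)
  finally show ?thesis
    unfolding lhs by (simp add: N_def)
qed

end
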